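(* Every Halin graph $G$ with maximum degree $\Delta(G)\le 5$ is $(1,1,2,2,2)$-packing colorable; that is, $V(G)$ can be partitioned into five sets $V_1,V_2,V_3,V_4,V_5$ such that any two distinct vertices in the same set $V_1$ or in the same set $V_2$ are at distance at least $2$ in $G$, and any two distinct vertices in the same set $V_j$ with $j\in\{3,4,5\}$ are at distance at least $3$ in $G$.
   Context: A Halin graph is a plane graph constructed from a (plane) tree $T$ without vertices of degree two (the characteristic tree) by connecting all leaves of $T$ through a cycle $C$ (the adjoint cycle, which visits the leaves in their cyclic order in the plane embedding). For a non-decreasing sequence $S=(s_1,\dots,s_k)$ of positive integers, an $S$-packing coloring of a simple graph $G$ is a partition of $V(G)$ into $k$ disjoint subsets $V_1,\dots,V_k$ (some possibly empty) such that for each $i$, any two distinct vertices $u,v\in V_i$ satisfy $d_G(u,v)\ge s_i+1$, where $d_G$ is the graph distance. $G$ is $S$-packing colorable if it has an $S$-packing coloring. The sequence $(1,1,2,2,2)$ is also written $(1^2,2^3)$. *)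

theory Defs
  imports "Graph_Theory.Graph_Theory" "HOL-Combinatorics.Orbits" "HOL-Library.Disjoint_Sets"
begin

text \<open>
  A finite simple graph is a \<^locale>\<open>pair_graph\<close>: a finite, loop-free, symmetric set of arcs
  \<open>(u, v)\<close>, so each undirected edge is the pair of its two orientations and the degree
  of a vertex is its out-degree.
\<close>

definition max_degree :: "'a pair_pre_digraph \<Rightarrow> nat" where
  "max_degree G = Max (out_degree G ` pverts G)"

text \<open>Unit arc weights; the distance is \<open>\<infinity>\<close> between different components.\<close>

definition graph_dist :: "'a pair_pre_digraph \<Rightarrow> 'a \<Rightarrow> 'a \<Rightarrow> ereal" where
  "graph_dist G u v = wf_digraph.\<mu> G (\<lambda>_. 1) u v"


section \<open>Plane trees\<close>

text \<open>
  The library's notion of tree is meant for directed graphs: in a symmetric digraph every edge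
  gives a directed cycle of length two. The undirected cycles are the directed cycles of length
  at least three.
\<close>

definition undirected_tree :: "'a pair_pre_digraph \<Rightarrow> bool" where
  "undirected_tree T \<longleftrightarrow> pair_graph T \<and> connected T \<and>
     (\<nexists>p. pre_digraph.cycle T p \<and> 3 \<le> length p)"

text \<open>
  A plane embedding is given by its rotation system: \<open>\<sigma>\<close> maps each arc leaving a vertex to the
  next arc leaving that vertex in the (say, clockwise) cyclic order around it. A rotation system
  on a connected graph describes an embedding in the plane iff it has Euler genus zero; for a
  tree, this holds for every rotation system, since there is exactly one face.
\<close>

locale plane_tree =
  fixes T :: "'a pair_pre_digraph" and \<sigma> :: "'a \<times> 'a \<Rightarrow> 'a \<times> 'a"
  assumes tree: "undirected_tree T"
    and permutes_arcs: "\<sigma> permutes parcs T"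
    and rotation: "\<And>v. v \<in> pverts T \<Longrightarrow> out_arcs T v \<noteq> {} \<Longrightarrow> cyclic_on \<sigma> (out_arcs T v)"

text \<open>
  One step of the walk along the boundary of a face: having traversed the arc \<open>a\<close> from \<open>u\<close>
  to \<open>v\<close>, continue with the arc that follows \<open>(v, u)\<close> in the rotation at \<open>v\<close>.
\<close>

definition face_succ :: "('a \<times> 'a \<Rightarrow> 'a \<times> 'a) \<Rightarrow> 'a \<times> 'a \<Rightarrow> 'a \<times> 'a" where
  "face_succ \<sigma> a = \<sigma> (snd a, fst a)"

definition leaves :: "'a pair_pre_digraph \<Rightarrow> 'a set" where
  "leaves T = {v \<in> pverts T. out_degree T v = 1}"

text \<open>
  The boundary walk of the unique face of a plane tree passes through each leaf exactly once, and
  this gives the cyclic order of the leaves in the embedding: \<open>v\<close> follows \<open>u\<close> if \<open>v\<close> is the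
  first leaf the walk meets after leaving \<open>u\<close>.
\<close>

definition next_leaf ::
  "'a pair_pre_digraph \<Rightarrow> ('a \<times> 'a \<Rightarrow> 'a \<times> 'a) \<Rightarrow> 'a \<Rightarrow> 'a \<Rightarrow> bool" where
  "next_leaf T \<sigma> u v \<longleftrightarrow> u \<in> leaves T \<and> v \<in> leaves T \<and>
     (\<exists>a\<in>parcs T. \<exists>k>0. fst a = u \<and> fst ((face_succ \<sigma> ^^ k) a) = v \<and>
        (\<forall>i. 0 < i \<and> i < k \<longrightarrow> fst ((face_succ \<sigma> ^^ i) a) \<notin> leaves T))"


section \<open>Halin graphs\<close>

definition cycle_arcs :: "'a list \<Rightarrow> ('a \<times> 'a) set" where
  "cycle_arcs cs = (let E = {(cs ! i, cs ! (Suc i mod length cs)) |i. i < length cs} in E \<union> E\<inverse>)"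

text \<open>
  \<open>cs\<close> lists the vertices of the adjoint cycle in order. As a cycle of a simple graph it has at
  least three vertices, which excludes the trees with one or two vertices.
\<close>

definition adjoint_cycle ::
  "'a pair_pre_digraph \<Rightarrow> ('a \<times> 'a \<Rightarrow> 'a \<times> 'a) \<Rightarrow> 'a list \<Rightarrow> bool" where
  "adjoint_cycle T \<sigma> cs \<longleftrightarrow> 3 \<le> length cs \<and> distinct cs \<and> set cs = leaves T \<and>
     (\<forall>i<length cs. next_leaf T \<sigma> (cs ! i) (cs ! (Suc i mod length cs)))"

definition halin :: "'a pair_pre_digraph \<Rightarrow> bool" where
  "halin G \<longleftrightarrow> (\<exists>T \<sigma> cs. plane_tree T \<sigma> \<and> (\<forall>v\<in>pverts T. out_degree T v \<noteq> 2) \<and>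
     adjoint_cycle T \<sigma> cs \<and>
     pverts G = pverts T \<and> parcs G = parcs T \<union> cycle_arcs cs)"


section \<open>Packing colorings\<close>

text \<open>
  Colour classes are indexed from \<open>0\<close>: the class \<open>V i\<close> belongs to the entry \<open>S ! i\<close>, and may be
  empty. \<open>S\<close> is meant to be a non-decreasing list of positive integers.
\<close>

definition packing_coloring :: "'a pair_pre_digraph \<Rightarrow> nat list \<Rightarrow> (nat \<Rightarrow> 'a set) \<Rightarrow> bool" where
  "packing_coloring G S V \<longleftrightarrow>
     (\<Union>i<length S. V i) = pverts G \<and>
     disjoint_family_on V {..<length S} \<and>
     (\<forall>i<length S. \<forall>u\<in>V i. \<forall>v\<in>V i. u \<noteq> v \<longrightarrow> ereal (real (S ! i + 1)) \<le> graph_dist G u v)"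

definition packing_colorable :: "'a pair_pre_digraph \<Rightarrow> nat list \<Rightarrow> bool" where
  "packing_colorable G S \<longleftrightarrow> (\<exists>V. packing_coloring G S V)"

end

theory Submission
  imports Defs
begin

text \<open>
  Write the Halin graph as the tree \<open>T\<close> plus the cycle \<open>C\<close> through its leaves. As a bipartite
  graph, \<open>T\<close> has a proper colouring with the two colours of radius one. Only edges of \<open>C\<close> can be
  violated by it, so it is enough to recolour a set \<open>W\<close> of leaves that meets every edge of \<open>C\<close>,
  with the three colours of radius two. Two leaves have distance at most two iff they have
  distance at most two along \<open>C\<close> or have the same parent, so these are the conflicts to respect
  within \<open>W\<close>.

  Take for \<open>W\<close> every second leaf along \<open>C\<close>, and one more leaf if the length of \<open>C\<close> is odd
  (\<open>selected\<close>). Along \<open>C\<close> a member of \<open>W\<close> then conflicts only with its predecessor and its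
  successor in \<open>W\<close>. What remains is to control siblings, and this is where the embedding and the
  degree bound enter. Siblings that are consecutive in the rotation around their parent are
  consecutive on \<open>C\<close> (\<open>next_leaf_rotation\<close>). Hence three leaves with the same parent that are
  pairwise non-adjacent on \<open>C\<close> are separated by three further arcs at the parent, which then has
  degree at least six (\<open>card_separated_siblings\<close>). So away from the extra leaf each member of
  \<open>W\<close> has at most one sibling in \<open>W\<close>, and colouring \<open>W\<close> greedily along \<open>C\<close> meets at most two
  earlier conflicts at each step: the predecessor and one sibling.

  The greedy argument could fail only at the end, where the last member of \<open>W\<close> also meets the
  first one. So \<open>C\<close> is cut open at a well-chosen place. The tree formed by the inner vertices has a
  vertex \<open>p\<close> with at most one neighbour in it. The leaves around \<open>p\<close> follow one another on \<open>C\<close>,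
  and one of them, \<open>x\<close>, is within distance two of all the others (\<open>bunched_siblings\<close>). If \<open>x\<close> is
  coloured last, with the extra member of \<open>W\<close> for odd length placed there too, its siblings
  in \<open>W\<close> are among its two neighbours in the cyclic order of \<open>W\<close>, and again there are at most two
  conflicts (\<open>selected_colouring\<close>).
\<close>


section \<open>Packing colorings as colour functions\<close>

lemma graph_dist_ge_2:
  assumes "wf_digraph (with_proj G)" and "u \<noteq> v" and "(u, v) \<notin> parcs G"
  shows "2 \<le> graph_dist G u v"
proof -
  interpret wf_digraph "with_proj G" by fact
  have "2 \<le> ereal (awalk_cost (\<lambda>_. 1) p)" if "awalk u p v" for p
  proof -
    have "2 \<le> length p"
      using that assms(2,3)
      by (cases p; cases "tl p") (auto simp: awalk_def)
    then show ?thesis by (simp add: awalk_cost_def sum_list_triv)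
  qed
  then show ?thesis
    unfolding graph_dist_def \<mu>_def by (intro INF_greatest) auto
qed

lemma graph_dist_ge_3:
  assumes "wf_digraph (with_proj G)" and "u \<noteq> v" and "(u, v) \<notin> parcs G"
    and "\<And>w. (u, w) \<in> parcs G \<Longrightarrow> (w, v) \<notin> parcs G"
  shows "3 \<le> graph_dist G u v"
proof -
  interpret wf_digraph "with_proj G" by fact
  have "3 \<le> ereal (awalk_cost (\<lambda>_. 1) p)" if "awalk u p v" for p
  proof -
    have "3 \<le> length p"
      using that assms(2-4)
      by (cases p; cases "tl p"; cases "tl (tl p)") (auto simp: awalk_def)
    then show ?thesis by (simp add: awalk_cost_def sum_list_triv)
  qed
  then show ?thesis
    unfolding graph_dist_def \<mu>_def by (intro INF_greatest) auto
qed

text \<open>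
  A colour function with values below five yields the classes as its fibres. The colours 0 and 1
  are the classes of radius one, which only have to be independent; the colours from 2 on are
  the classes of radius two, in which common neighbours are forbidden too.
\<close>

lemma packing_colorable_11222I:
  fixes col :: "'a \<Rightarrow> nat"
  assumes wf: "wf_digraph (with_proj G)"
    and range: "\<And>v. v \<in> pverts G \<Longrightarrow> col v < 5"
    and adj: "\<And>u v. (u, v) \<in> parcs G \<Longrightarrow> u \<noteq> v \<Longrightarrow> col u \<noteq> col v"
    and dist2: "\<And>u v w. (u, w) \<in> parcs G \<Longrightarrow> (w, v) \<in> parcs G \<Longrightarrow> u \<noteq> v \<Longrightarrow> 2 \<le> col u
      \<Longrightarrow> col u \<noteq> col v"
  shows "packing_colorable G [1, 1, 2, 2, 2]"
proof -
  let ?S = "[1, 1, 2, 2, 2] :: nat list"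
  define V where "V i = {v \<in> pverts G. col v = i}" for i
  have "ereal (real (?S ! i + 1)) \<le> graph_dist G u v"
    if "i < length ?S" "u \<in> V i" "v \<in> V i" "u \<noteq> v" for i u v
  proof -
    have na: "(u, v) \<notin> parcs G" using adj[of u v] that by (auto simp: V_def)
    show ?thesis
    proof (cases "i < 2")
      case True
      then have "i = 0 \<or> i = 1" by auto
      then have "?S ! i = 1" by auto
      then show ?thesis using graph_dist_ge_2[OF wf \<open>u \<noteq> v\<close> na] by simp
    next
      case False
      then have "i = 2 \<or> i = 3 \<or> i = 4" using that(1) by auto
      then have S: "?S ! i = 2" by auto
      have "3 \<le> graph_dist G u v"
        by (rule graph_dist_ge_3[OF wf \<open>u \<noteq> v\<close> na])
          (use dist2[of u _ v] that False in \<open>auto simp: V_def\<close>)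
      then show ?thesis unfolding S by simp
    qed
  qed
  moreover have "(\<Union>i<length ?S. V i) = pverts G"
    using range by (auto simp: V_def eval_nat_numeral)
  moreover have "disjoint_family_on V {..<length ?S}"
    by (auto simp: disjoint_family_on_def V_def)
  ultimately show ?thesis
    unfolding packing_colorable_def packing_coloring_def by blast
qed


section \<open>Acyclic symmetric relations\<close>

text \<open>
  A cycle is given by its vertex list. The length bound leaves out the closed walk that
  traverses an edge back and forth, which every nonempty symmetric relation contains.
\<close>

definition acyclic_edges :: "('a \<times> 'a) set \<Rightarrow> bool" where
  "acyclic_edges E \<longleftrightarrow> (\<forall>xs. distinct xs \<and> 3 \<le> length xs \<and> successively (\<lambda>x y. (x, y) \<in> E) xs
     \<longrightarrow> (last xs, hd xs) \<notin> E)"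

lemma acyclic_edges_subset: "acyclic_edges E \<Longrightarrow> F \<subseteq> E \<Longrightarrow> acyclic_edges F"
  unfolding acyclic_edges_def
  by (meson in_mono successively_mono)

text \<open>
  Translates paths given by vertex lists into the arc walks in terms of which trees are defined.
\<close>

lemma awalk_of_successively:
  assumes "pair_wf_digraph T" "xs \<noteq> []" "successively (\<lambda>x y. (x, y) \<in> parcs T) xs" "hd xs \<in> pverts T"
  shows "pre_digraph.awalk T (hd xs) (zip xs (tl xs)) (last xs)
    \<and> pre_digraph.awalk_verts T (hd xs) (zip xs (tl xs)) = xs"
proof -
  interpret pair_wf_digraph T by fact
  show ?thesis using assms(2-4)
  proof (induction xs rule: induct_list012)
    case (3 x y zs)
    then show ?case using in_arcsD2[of x y]
      by (auto simp: awalk_def)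
  qed (auto simp: awalk_def)
qed

lemma undirected_tree_acyclic_edges:
  assumes "undirected_tree T"
  shows "acyclic_edges (parcs T)"
  unfolding acyclic_edges_def
proof (intro allI impI notI, elim conjE)
  fix xs assume xs: "distinct xs" "3 \<le> length xs" "successively (\<lambda>x y. (x, y) \<in> parcs T) xs"
    and close: "(last xs, hd xs) \<in> parcs T"
  interpret pair_graph T using assms by (simp add: undirected_tree_def)
  have ne: "xs \<noteq> []" using xs(2) by auto
  let ?ys = "xs @ [hd xs]"
  let ?p = "zip ?ys (tl ?ys)"
  have "successively (\<lambda>x y. (x, y) \<in> parcs T) ?ys"
    using xs close by (auto simp: successively_append_iff)
  with awalk_of_successively[of T ?ys] ne close
  have "awalk (hd xs) ?p (hd xs)" "pawalk_verts (hd xs) ?p = ?ys"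
    by (auto dest: in_arcsD2 intro: pair_wf_digraph)
  moreover have "distinct (tl ?ys)"
    using xs(1) ne by (cases xs) auto
  moreover have "3 \<le> length ?p" using xs(2) by simp
  ultimately have "cycle ?p \<and> 3 \<le> length ?p"
    unfolding cycle_def by (metis list.size(3) not_numeral_le_zero)
  then show False using assms by (auto simp: undirected_tree_def)
qed

text \<open>
  All neighbours of the first vertex of a longest path lie on the path. If one of them were not
  the second vertex, the path up to it would close to a cycle.
\<close>

lemma acyclic_edges_end:
  assumes "finite V" "V \<noteq> {}" "E \<subseteq> V \<times> V" "sym E" "irrefl E" "acyclic_edges E"
  shows "\<exists>v\<in>V. \<forall>x y. (v, x) \<in> E \<longrightarrow> (v, y) \<in> E \<longrightarrow> x = y"
proof -
  define P where "P xs \<longleftrightarrow> xs \<noteq> [] \<and> distinct xs \<and> set xs \<subseteq> V \<and> successively (\<lambda>x y. (x, y) \<in> E) xs"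
    for xs
  obtain a where "a \<in> V" using assms(2) by auto
  then have "P [a]" by (simp add: P_def)
  moreover have "length xs < Suc (card V)" if "P xs" for xs
    using that assms(1) by (metis P_def card_mono distinct_card less_Suc_eq_le)
  ultimately obtain xs where xs: "P xs" and max: "\<And>ys. P ys \<Longrightarrow> length ys \<le> length xs"
    using ex_has_greatest_nat[of P "[a]" length "Suc (card V)"] by (metis less_imp_le)
  let ?v = "hd xs"
  have ne: "xs \<noteq> []" and v: "?v \<in> V" using xs by (auto simp: P_def)
  have pos: "\<exists>i>0. i < length xs \<and> xs ! i = x" if "(?v, x) \<in> E" for x
  proof -
    have "x \<in> set xs"
    proof (rule ccontr)
      assume "x \<notin> set xs"
      then have "P (x # xs)"
        using xs that assms(3,4) by (auto simp: P_def successively_Cons dest: symD)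
      then show False using max by fastforce
    qed
    then obtain i where i: "i < length xs" "xs ! i = x" by (auto simp: in_set_conv_nth)
    have "x \<noteq> ?v" using that assms(5) by (auto simp: irrefl_def)
    then have "i > 0" using i ne by (cases i) (auto simp: hd_conv_nth)
    with i show ?thesis by blast
  qed
  \<comment> \<open>A chord from the first vertex to a vertex beyond the second closes a cycle.\<close>
  have no: False if "(?v, xs ! j) \<in> E" "j < length xs" "2 \<le> j" for j
  proof -
    let ?ys = "take (Suc j) xs"
    have "distinct ?ys" "3 \<le> length ?ys" "successively (\<lambda>x y. (x, y) \<in> E) ?ys"
      using xs that 
      by (auto simp: P_def)
       (metis append_take_drop_id successively_append_iff)
    moreover have "last ?ys = xs ! j" using that by (simp add: take_Suc_conv_app_nth)
    moreover have "hd ?ys = ?v" by simp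
    ultimately show False
      using assms(4,6) that(1) unfolding acyclic_edges_def by (metis symD)
  qed
  show ?thesis
  proof (intro bexI[OF _ v] allI impI)
    fix x y assume "(?v, x) \<in> E" "(?v, y) \<in> E"
    with pos obtain i j where "0 < i" "i < length xs" "x = xs ! i" "0 < j" "j < length xs" "y = xs ! j"
      by metis
    moreover then have "\<not> 2 \<le> i" "\<not> 2 \<le> j"
      using no \<open>(?v, x) \<in> E\<close> \<open>(?v, y) \<in> E\<close> by auto
    ultimately show "x = y" by (auto simp: not_le less_2_cases_iff)
  qed
qed

text \<open>
  Remove a vertex with at most one neighbour, colour the rest by induction, and give the removed
  vertex the colour that its neighbour does not have.
\<close>

lemma acyclic_edges_bipartite:
  assumes "finite V" "E \<subseteq> V \<times> V" "sym E" "irrefl E" "acyclic_edges E"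
  shows "\<exists>c :: 'a \<Rightarrow> bool. \<forall>x y. (x, y) \<in> E \<longrightarrow> c x \<noteq> c y"
  using assms
proof (induction "card V" arbitrary: V E)
  case 0
  then show ?case by auto
next
  case (Suc n)
  then have "V \<noteq> {}" by auto
  then obtain v where v: "v \<in> V" "\<And>x y. (v, x) \<in> E \<Longrightarrow> (v, y) \<in> E \<Longrightarrow> x = y"
    using acyclic_edges_end[of V E] Suc.prems by blast
  let ?E = "E \<inter> (V - {v}) \<times> (V - {v})"
  have "\<exists>c :: 'a \<Rightarrow> bool. \<forall>x y. (x, y) \<in> ?E \<longrightarrow> c x \<noteq> c y"
  proof (rule Suc.hyps(1))
    show "n = card (V - {v})" using Suc.hyps(2) v(1) Suc.prems(1) by simp
    show "sym ?E" using Suc.prems(3) by (auto simp: sym_def)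
    show "irrefl ?E" using Suc.prems(4) by (auto simp: irrefl_def)
    show "acyclic_edges ?E" using Suc.prems(5) by (rule acyclic_edges_subset) auto
  qed (use Suc.prems in auto)
  then obtain c :: "'a \<Rightarrow> bool" where c: "\<And>x y. (x, y) \<in> ?E \<Longrightarrow> c x \<noteq> c y" by blast
  let ?c = "c(v := (\<exists>x. (v, x) \<in> E \<and> \<not> c x))"
  have "?c x \<noteq> ?c y" if "(x, y) \<in> E" for x y
  proof -
    have "x \<noteq> y" and yx: "(y, x) \<in> E" using that Suc.prems by (auto simp: irrefl_def dest: symD)
    then consider "x = v" "y \<noteq> v" | "y = v" "x \<noteq> v" | "x \<noteq> v" "y \<noteq> v" by blast
    then show ?thesis
    proof cases
      case 3
      then have "(x, y) \<in> ?E" using that Suc.prems(2) by auto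
      then show ?thesis using c 3 by simp
    qed (use that yx v(2) in auto)
  qed
  then show ?case by blast
qed


section \<open>Colouring alternate positions of a cycle\<close>

lemma greedy_colouring:
  fixes R :: "nat \<Rightarrow> nat \<Rightarrow> bool"
  assumes "\<And>i. i \<in> S \<Longrightarrow> card {j \<in> S. j < i \<and> R i j} < k"
  shows "\<exists>f :: nat \<Rightarrow> nat. (\<forall>i\<in>S. f i < k) \<and> (\<forall>i\<in>S. \<forall>j\<in>S. j < i \<longrightarrow> R i j \<longrightarrow> f i \<noteq> f j)"
proof -
  \<comment> \<open>E i holds the earlier conflicts of i; F picks a colour below k that is not used on them.\<close>
  define E where "E i = {j \<in> S. j < i \<and> R i j}" for i
  define F where "F f i = (SOME x. x < k \<and> x \<notin> f ` E i)" for f :: "nat \<Rightarrow> nat" and i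
  define f where "f = wfrec less_than F"
  have f: "f i = F f i" for i
  proof -
    have "F (cut f less_than i) i = F f i"
      by (simp add: F_def E_def cut_def image_def cong: conj_cong)
    then show ?thesis
      unfolding f_def by (subst wfrec) (auto simp: f_def)
  qed
  have "f i < k \<and> f i \<notin> f ` E i" if "i \<in> S" for i
  proof -
    have fin: "finite (E i)" by (simp add: E_def)
    have "card (f ` E i) < card {..<k}"
      using assms[OF that] card_image_le[OF fin, of f] by (simp add: E_def)
    then have "\<not> {..<k} \<subseteq> f ` E i"
      using card_mono[OF finite_imageI[OF fin]] by (meson leD)
    then have "\<exists>x. x < k \<and> x \<notin> f ` E i" by auto
    from someI_ex[OF this] show ?thesis by (simp add: f[of i] F_def)
  qed
  then show ?thesis unfolding E_def by (intro exI[of _ f]) blast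
qed

text \<open>
  Positions on a cycle of length \<open>n\<close>, numbered from \<open>0\<close>. For even \<open>n\<close> these are the odd
  positions. For odd \<open>n\<close> the positions \<open>n - 1\<close> and \<open>0\<close> are adjacent and both even, so the last
  position is added. In either case \<open>0\<close> is left out, and two selected positions at cyclic
  distance at most two are cyclically consecutive selected positions.
\<close>

definition selected :: "nat \<Rightarrow> nat set" where
  "selected n = {i. i < n \<and> (odd i \<or> i = n - 1)}"

lemma selected_cover:
  assumes "i < n"
  shows "i \<in> selected n \<or> Suc i mod n \<in> selected n"
  using assms by (cases "Suc i = n") (auto simp: selected_def)

text \<open>
  Think of \<open>p i\<close> as the parent of the leaf at position \<open>i\<close>. Colour the selected positions
  greedily in increasing order. A position \<open>i < n - 1\<close> has at most two earlier conflicts: the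
  position \<open>i - 2\<close>, and one sibling, since two earlier selected siblings would form with \<open>i\<close> three
  pairwise non-adjacent siblings. The last position meets both its predecessor and the position
  \<open>1\<close> on the other side of the seam; it acquires no third conflict because all its siblings are
  close to it, so that the selected ones among them are these two.
\<close>

lemma selected_colouring:
  fixes p :: "nat \<Rightarrow> 'b"
  assumes n: "3 \<le> n"
    and sparse: "\<And>i j k. Suc i < j \<Longrightarrow> Suc j < k \<Longrightarrow> Suc k < n \<Longrightarrow> p i = p j \<Longrightarrow> p j \<noteq> p k"
    and bunched: "\<And>j. j < n \<Longrightarrow> p j = p (n - 1) \<Longrightarrow> j \<le> 1 \<or> n \<le> j + 3"
  shows "\<exists>f :: nat \<Rightarrow> nat. (\<forall>i \<in> selected n. f i < 3) \<and>
    (\<forall>i \<in> selected n. \<forall>j \<in> selected n. i \<noteq> j \<longrightarrow>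
       p i = p j \<or> j = Suc i mod n \<or> j = Suc (Suc i) mod n \<longrightarrow> f i \<noteq> f j)"
proof -
  define Q where "Q i j \<longleftrightarrow> p i = p j \<or> j = Suc i mod n \<or> j = Suc (Suc i) mod n" for i j
  define R where "R i j \<longleftrightarrow> Q i j \<or> Q j i" for i j
  let ?S = "selected n"
  have "card {j \<in> ?S. j < i \<and> R i j} < 3" if i: "i \<in> ?S" for i
  proof (cases "i = n - 1")
    case True
    \<comment> \<open>The last selected position before n - 1.\<close>
    let ?prev = "if odd n then n - 2 else n - 3"
    have "{j \<in> ?S. j < i \<and> R i j} \<subseteq> {?prev, 1}"
    proof
      fix j assume "j \<in> {j \<in> ?S. j < i \<and> R i j}"
      then have j: "odd j" "j < n - 1" "R i j"
        using True by (auto simp: selected_def)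
      from \<open>R i j\<close> have "j \<le> 1 \<or> n \<le> j + 3"
        unfolding R_def Q_def
      proof (elim disjE)
        assume "i = Suc j mod n" then show ?thesis using True j n by auto
      next
        assume "i = Suc (Suc j) mod n" then show ?thesis using True j n
          by (cases "Suc (Suc j) = n") auto
      next
        assume "j = Suc (Suc i) mod n" then show ?thesis using True n by (simp add: mod_if)
      qed (use True bunched[of j] j n in auto)
      then consider "j = 1" | "j = n - 2" | "j = n - 3"
        using j n by (cases j) force+
      then show "j \<in> {?prev, 1}"
        using j n by cases auto
    qed
    then have "card {j \<in> ?S. j < i \<and> R i j} \<le> card {?prev, 1}"
      by (intro card_mono) auto
    also have "\<dots> < 3" by (auto simp: card_insert_if)
    finally show ?thesis .
  next
    case False
    then have i: "odd i" "i < n - 1" using i by (auto simp: selected_def)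
    let ?sib = "{j. odd j \<and> j < i \<and> p j = p i}"
    have "{j \<in> ?S. j < i \<and> R i j} \<subseteq> insert (i - 2) ?sib"
    proof
      fix j assume "j \<in> {j \<in> ?S. j < i \<and> R i j}"
      then have j: "odd j" "j < i" "R i j"
        using i by (auto simp: selected_def)
      then have "j = i - 2 \<or> p j = p i"
        using i n unfolding R_def Q_def
        by (auto simp: mod_if split: if_splits)
      then show "j \<in> insert (i - 2) ?sib" using j by auto
    qed
    then have "card {j \<in> ?S. j < i \<and> R i j} \<le> card (insert (i - 2) ?sib)"
      by (intro card_mono) auto
    also have "\<dots> \<le> Suc (card ?sib)" by (simp add: card_insert_if)
    also have "card ?sib \<le> Suc 0"
    proof -
      have "j = k" if "j \<in> ?sib" "k \<in> ?sib" for j k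
      proof -
        have *: False if "j < k" "j \<in> ?sib" "k \<in> ?sib" for j k
        proof -
          have "Suc j \<noteq> k" "Suc k \<noteq> i" using that i by auto
          moreover have "Suc i < n" using i by linarith
          ultimately show False using sparse[of j k i] that by auto
        qed
        show ?thesis using *[of j k] *[of k j] that by (meson linorder_neqE_nat)
      qed
      then show ?thesis by (subst card_le_Suc0_iff_eq) auto
    qed
    finally show ?thesis by simp
  qed
  then obtain f :: "nat \<Rightarrow> nat" where "\<forall>i\<in>?S. f i < 3"
    and f: "\<forall>i\<in>?S. \<forall>j\<in>?S. j < i \<longrightarrow> R i j \<longrightarrow> f i \<noteq> f j"
    using greedy_colouring[of ?S R 3] by blast
  moreover have "f i \<noteq> f j" if "i \<in> ?S" "j \<in> ?S" "i \<noteq> j" "Q i j" for i j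
    using f[rule_format, of i j] f[rule_format, of j i] that by (metis R_def linorder_neqE_nat)
  ultimately show ?thesis unfolding Q_def by blast
qed


section \<open>Arcs of a cycle given by a vertex list\<close>

lemma cycle_arcs_rotate: "cycle_arcs (rotate m cs) = cycle_arcs cs"
proof (cases "cs = []")
  case False
  let ?n = "length cs"
  have n: "?n > 0" using False by simp
  have "{(rotate m cs ! i, rotate m cs ! (Suc i mod ?n)) |i. i < ?n}
      = {(cs ! i, cs ! (Suc i mod ?n)) |i. i < ?n}" (is "?L = ?R")
  proof -
    have "?L = (\<lambda>i. (rotate m cs ! i, rotate m cs ! (Suc i mod ?n))) ` {..<?n}" by auto
    also have "\<dots> = (\<lambda>i. (cs ! i, cs ! (Suc i mod ?n))) ` (\<lambda>i. (m + i) mod ?n) ` {..<?n}"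
      unfolding image_image using n by (intro image_cong) (auto simp: nth_rotate mod_simps)
    also have "(\<lambda>i. (m + i) mod ?n) ` {..<?n} = {..<?n}"
    proof
      show "{..<?n} \<subseteq> (\<lambda>i. (m + i) mod ?n) ` {..<?n}"
      proof
        fix j assume "j \<in> {..<?n}"
        moreover have "(m + (j + (?n - m mod ?n)) mod ?n) mod ?n
            = (m mod ?n + (j + (?n - m mod ?n))) mod ?n"
          by (simp add: mod_simps)
        moreover have "m mod ?n + (j + (?n - m mod ?n)) = j + ?n"
          using mod_less_divisor[OF n, of m] by linarith
        ultimately show "j \<in> (\<lambda>i. (m + i) mod ?n) ` {..<?n}"
          using n by (intro image_eqI[of _ _ "(j + (?n - m mod ?n)) mod ?n"]) auto
      qed
    qed (use n in auto)
    also have "(\<lambda>i. (cs ! i, cs ! (Suc i mod ?n))) ` {..<?n} = ?R" by auto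
    finally show ?thesis .
  qed
  then show ?thesis by (simp add: cycle_arcs_def)
qed simp

text \<open>
  Lets a function on the positions of a cycle be read as a function of the vertices there.
\<close>

lemma distinct_nth_function:
  assumes "distinct xs"
  shows "\<exists>g. \<forall>i<length xs. g (xs ! i) = h i"
proof (intro exI allI impI)
  fix i assume "i < length xs"
  then show "(h \<circ> the_inv_into {..<length xs} ((!) xs)) (xs ! i) = h i"
    using the_inv_into_f_f[OF inj_on_nth[OF assms]] by auto
qed

lemma cycle_arcs_nthD:
  assumes "distinct ds" "i < length ds" "(ds ! i, y) \<in> cycle_arcs ds"
  shows "\<exists>j<length ds. y = ds ! j \<and> (j = Suc i mod length ds \<or> i = Suc j mod length ds)"
proof -
  let ?n = "length ds"
  have lt: "Suc k mod ?n < ?n" for k using assms(2) by (intro mod_less_divisor) auto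
  from assms(3) obtain k where k: "k < ?n"
    "ds ! i = ds ! k \<and> y = ds ! (Suc k mod ?n) \<or> ds ! i = ds ! (Suc k mod ?n) \<and> y = ds ! k"
    by (auto simp: cycle_arcs_def Let_def)
  then show ?thesis
    using nth_eq_iff_index_eq[OF assms(1)] assms(2) lt by metis
qed

lemma cycle_arcs_subset: "cycle_arcs ds \<subseteq> set ds \<times> set ds"
proof -
  have "Suc i mod length ds < length ds" if "i < length ds" for i
    using that by (intro mod_less_divisor) auto
  then show ?thesis by (auto simp: cycle_arcs_def Let_def)
qed


section \<open>Leaves and rotations of a plane tree\<close>

lemma connected_closed_subset:
  assumes "pair_graph T" and "connected T" and "u \<in> S" and "u \<in> pverts T"
    and closed: "\<And>x y. x \<in> S \<Longrightarrow> (x, y) \<in> parcs T \<Longrightarrow> y \<in> S"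
  shows "pverts T \<subseteq> S"
proof
  fix v assume "v \<in> pverts T"
  interpret pair_graph T by fact
  have "u \<rightarrow>\<^sup>*\<^bsub>with_proj T\<^esub> v"
    using assms(2,4) \<open>v \<in> pverts T\<close> reachable_mk_symmetric_eq[OF sym_arcs]
    by (auto simp: connected_def strongly_connected_def)
  then have "(u, v) \<in> (parcs T)\<^sup>*"
    using reachable_rtranclI by fastforce
  then show "v \<in> S"
    by induction (use \<open>u \<in> S\<close> closed in auto)
qed

lemma cyclic_on_eq_funpow_image:
  assumes "cyclic_on f S" "s \<in> S" "card S \<le> k"
  shows "S = (\<lambda>m. (f ^^ m) s) ` {..<k}"
proof
  have S: "S = orbit f s" using assms(1,2) by (auto simp: cyclic_on_alldef)
  then have s: "s \<in> orbit f s" using assms(2) by simp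
  have "card S = funpow_dist1 f s s"
    unfolding S by (subst orbit_conv_funpow_dist1[OF s])
      (simp add: card_image inj_on_funpow_dist1[OF s] del: funpow.simps)
  then have "funpow_dist1 f s s \<le> k" using assms(3) by simp
  then show "S \<subseteq> (\<lambda>m. (f ^^ m) s) ` {..<k}"
    unfolding S by (subst orbit_conv_funpow_dist1[OF s]) (intro image_mono, auto)
  show "(\<lambda>m. (f ^^ m) s) ` {..<k} \<subseteq> S"
    using cyclic_on_funpow_in[OF assms(1,2)] by auto
qed

context plane_tree
begin

lemma pair_graph_T: "pair_graph T"
  using tree by (simp add: undirected_tree_def)

lemma arc_verts: "(x, y) \<in> parcs T \<Longrightarrow> x \<in> pverts T \<and> y \<in> pverts T"
proof -
  interpret pair_graph T by (rule pair_graph_T)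
  show "(x, y) \<in> parcs T \<Longrightarrow> x \<in> pverts T \<and> y \<in> pverts T" using in_arcsD1 in_arcsD2 by blast
qed

lemma arc_sym: "(x, y) \<in> parcs T \<Longrightarrow> (y, x) \<in> parcs T"
proof -
  interpret pair_graph T by (rule pair_graph_T)
  show "(x, y) \<in> parcs T \<Longrightarrow> (y, x) \<in> parcs T" using arcs_symmetric by blast
qed

lemma finite_T: "finite (pverts T)" "finite (parcs T)"
proof -
  interpret pair_graph T by (rule pair_graph_T)
  show "finite (pverts T)" "finite (parcs T)" by auto
qed

lemma leaf_neighbour_unique:
  assumes "l \<in> leaves T" "(l, x) \<in> parcs T" "(l, y) \<in> parcs T"
  shows "x = y"
proof -
  obtain a where a: "out_arcs T l = {a}"
    using assms(1) card_1_singletonE unfolding leaves_def out_degree_def by blast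
  have "(l, x) \<in> out_arcs T l" "(l, y) \<in> out_arcs T l" using assms(2,3) by simp_all
  then show ?thesis unfolding a by auto
qed

lemma leaf_has_neighbour:
  assumes "l \<in> leaves T"
  shows "\<exists>x. (l, x) \<in> parcs T"
proof -
  obtain a where "out_arcs T l = {a}"
    using assms card_1_singletonE unfolding leaves_def out_degree_def by blast
  then have "a \<in> out_arcs T l" by simp
  then show ?thesis by (intro exI[of _ "snd a"]) auto
qed

text \<open>
  Two adjacent leaves would form a connected component, hence be the whole tree.
\<close>

lemma leaf_neighbour_inner:
  assumes "3 \<le> card (leaves T)" "l \<in> leaves T" "(l, x) \<in> parcs T"
  shows "x \<notin> leaves T"
proof
  assume "x \<in> leaves T"
  have "pverts T \<subseteq> {l, x}"
  proof (rule connected_closed_subset[OF pair_graph_T, of l])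
    show "connected T" using tree by (simp add: undirected_tree_def)
    show "b \<in> {l, x}" if "a \<in> {l, x}" "(a, b) \<in> parcs T" for a b
      using that leaf_neighbour_unique[OF \<open>l \<in> leaves T\<close> \<open>(l, x) \<in> parcs T\<close>]
        leaf_neighbour_unique[OF \<open>x \<in> leaves T\<close> arc_sym[OF \<open>(l, x) \<in> parcs T\<close>]] by auto
  qed (use assms in \<open>auto simp: leaves_def\<close>)
  then have "card (leaves T) \<le> card {l, x}"
    by (intro card_mono) (auto simp: leaves_def)
  also have "\<dots> \<le> 2" by (auto simp: card_insert_if)
  finally show False using assms(1) by simp
qed

lemma rotation_arc:
  assumes "(v, x) \<in> parcs T"
  obtains y where "\<sigma> (v, x) = (v, y)" "(v, y) \<in> parcs T"
proof -
  have x: "(v, x) \<in> out_arcs T v" using assms by simp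
  then have "cyclic_on \<sigma> (out_arcs T v)"
    using rotation[of v] arc_verts[OF assms] by blast
  from cyclic_on_inI[OF this x] have "\<sigma> (v, x) \<in> parcs T" "fst (\<sigma> (v, x)) = v" by simp_all
  then show ?thesis by (intro that[of "snd (\<sigma> (v, x))"]) (metis prod.collapse)+
qed

text \<open>
  The boundary walk that leaves the leaf \<open>x\<close> enters its neighbour \<open>v\<close>, which is not a leaf, and
  turns to the next arc \<open>(v, y)\<close> in the rotation. So it reaches \<open>y\<close> in two steps without meeting a
  leaf in between: siblings that are consecutive in the rotation are consecutive on the cycle.
\<close>

lemma next_leaf_rotation:
  assumes "v \<notin> leaves T" "(v, x) \<in> parcs T" "y \<in> leaves T"
    and "\<sigma> (v, x) = (v, y)" and "next_leaf T \<sigma> x z"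
  shows "z = y"
proof -
  from assms(5) obtain a k where a: "a \<in> parcs T" "fst a = x" and k: "k > 0"
    and z: "z \<in> leaves T" "fst ((face_succ \<sigma> ^^ k) a) = z"
    and first: "\<And>i. 0 < i \<Longrightarrow> i < k \<Longrightarrow> fst ((face_succ \<sigma> ^^ i) a) \<notin> leaves T"
    and "x \<in> leaves T"
    unfolding next_leaf_def by blast
  have "a = (x, v)"
    using leaf_neighbour_unique[OF \<open>x \<in> leaves T\<close> arc_sym[OF assms(2)], of "snd a"] a
    by (cases a) auto
  then have 1: "(face_succ \<sigma> ^^ 1) a = (v, y)"
    using assms(4) by (simp add: face_succ_def)
  have "(y, v) \<in> parcs T"
  proof -
    obtain y' where "\<sigma> (v, x) = (v, y')" "(v, y') \<in> parcs T" using rotation_arc[OF assms(2)] .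
    then show ?thesis using assms(4) arc_sym by simp
  qed
  then obtain w where "\<sigma> (y, v) = (y, w)" by (rule rotation_arc)
  then have 2: "(face_succ \<sigma> ^^ 2) a = (y, w)"
    using 1 by (simp add: face_succ_def numeral_2_eq_2)
  have "k \<noteq> 1" using z 1 assms(1) by auto
  moreover have "\<not> 2 < k" using first[of 2] 2 assms(3) by auto
  ultimately have "k = 2" using k by linarith
  then show ?thesis using z(2) 2 by simp
qed

text \<open>
  The rotation maps the arcs to \<open>X\<close> injectively to arcs that do not lead to \<open>X\<close>, as otherwise
  two members of \<open>X\<close> would be consecutive on the cycle. So the arcs to \<open>X\<close> are at most half of
  the arcs at \<open>v\<close>. In particular a vertex of degree at most five has no three neighbouring leaves
  that are pairwise non-adjacent on the cycle.
\<close>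

lemma card_separated_siblings:
  assumes "v \<notin> leaves T" and "X \<subseteq> leaves T" and "\<And>x. x \<in> X \<Longrightarrow> (v, x) \<in> parcs T"
    and "\<And>x. x \<in> X \<Longrightarrow> next_leaf T \<sigma> x (nxt x)" and "\<And>x. x \<in> X \<Longrightarrow> nxt x \<notin> X"
  shows "2 * card X \<le> out_degree T v"
proof -
  let ?A = "Pair v ` X"
  have fin: "finite (out_arcs T v)"
    using finite_T(2) by (simp add: out_arcs_def)
  have A: "?A \<subseteq> out_arcs T v" using assms(3) by auto
  have sub: "\<sigma> ` ?A \<subseteq> out_arcs T v - ?A"
  proof
    fix b assume "b \<in> \<sigma> ` ?A"
    then obtain x where x: "x \<in> X" "b = \<sigma> (v, x)" by auto
    obtain y where y: "\<sigma> (v, x) = (v, y)" "(v, y) \<in> parcs T"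
      using rotation_arc assms(3)[OF x(1)] .
    have "y \<notin> X"
      using next_leaf_rotation[OF assms(1) assms(3)[OF x(1)] _ y(1) assms(4)[OF x(1)]]
        assms(2) assms(5)[OF x(1)] by auto
    then show "b \<in> out_arcs T v - ?A" using x y by auto
  qed
  have "card (\<sigma> ` ?A) = card X"
    using permutes_inj[OF permutes_arcs] by (simp add: card_image inj_on_subset inj_on_def)
  moreover have "card (out_arcs T v - ?A) = out_degree T v - card X"
    using card_Diff_subset[OF finite_subset[OF A fin] A]
    by (simp add: out_degree_def card_image inj_on_def)
  moreover have "card (\<sigma> ` ?A) \<le> card (out_arcs T v - ?A)"
    using sub fin by (intro card_mono) auto
  moreover have "card X \<le> out_degree T v"
    using card_mono[OF fin A] by (simp add: out_degree_def card_image inj_on_def)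
  ultimately show ?thesis by linarith
qed

text \<open>
  All but one of the at most five arcs at \<open>p\<close> lead to leaves. In the rotation these follow the
  exceptional arc \<open>(p, q)\<close>, so the leaves \<open>x1, x2, x3, x4\<close> (or fewer) are consecutive on the
  cycle, and \<open>x2\<close> is within distance two of each of them. If \<open>p\<close> has no neighbour but leaves,
  then \<open>q\<close> is a leaf as well, and it is followed by \<open>x1\<close>.
\<close>

lemma bunched_siblings:
  assumes p: "p \<in> pverts T" "p \<notin> leaves T"
    and deg: "3 \<le> out_degree T p" "out_degree T p \<le> 5"
    and outer: "\<And>x y. (p, x) \<in> parcs T \<Longrightarrow> (p, y) \<in> parcs T \<Longrightarrow> x \<notin> leaves T \<Longrightarrow> y \<notin> leaves T
      \<Longrightarrow> x = y"
    and nxt: "\<And>x. x \<in> leaves T \<Longrightarrow> next_leaf T \<sigma> x (nxt x)"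
  shows "\<exists>x \<in> leaves T. (p, x) \<in> parcs T \<and> (\<forall>y \<in> leaves T. (p, y) \<in> parcs T \<longrightarrow>
    y = x \<or> nxt y = x \<or> nxt (nxt y) = x \<or> y = nxt x \<or> y = nxt (nxt x))"
proof -
  let ?O = "out_arcs T p"
  have "?O \<noteq> {}" using deg(1) by (auto simp: out_degree_def)
  then have cyc: "cyclic_on \<sigma> ?O" using rotation p(1) by blast
  have "\<exists>q. (p, q) \<in> parcs T \<and> (\<forall>x. (p, x) \<in> parcs T \<longrightarrow> x \<noteq> q \<longrightarrow> x \<in> leaves T)"
  proof (cases "\<exists>q. (p, q) \<in> parcs T \<and> q \<notin> leaves T")
    case True
    then show ?thesis using outer by blast
  next
    case False
    obtain b where "b \<in> ?O" using \<open>?O \<noteq> {}\<close> by blast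
    then show ?thesis using False by (intro exI[of _ "snd b"]) auto
  qed
  then obtain q where q: "(p, q) \<in> parcs T"
    and leaf: "\<And>x. (p, x) \<in> parcs T \<Longrightarrow> x \<noteq> q \<Longrightarrow> x \<in> leaves T" by blast
  have qO: "(p, q) \<in> ?O" using q by simp
  obtain x1 where x1: "\<sigma> (p, q) = (p, x1)" "(p, x1) \<in> parcs T" using rotation_arc[OF q] .
  obtain x2 where x2: "\<sigma> (p, x1) = (p, x2)" "(p, x2) \<in> parcs T" using rotation_arc[OF x1(2)] .
  obtain x3 where x3: "\<sigma> (p, x2) = (p, x3)" "(p, x3) \<in> parcs T" using rotation_arc[OF x2(2)] .
  obtain x4 where x4: "\<sigma> (p, x3) = (p, x4)" "(p, x4) \<in> parcs T" using rotation_arc[OF x3(2)] .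
  \<comment> \<open>For degree less than five the orbit closes up early, and this list of arcs has repetitions.\<close>
  have "?O = (\<lambda>m. (\<sigma> ^^ m) (p, q)) ` {..<5}"
    using deg(2) by (intro cyclic_on_eq_funpow_image[OF cyc qO]) (simp add: out_degree_def)
  also have "{..<5} = {0, 1, 2, 3, 4 :: nat}" by auto
  finally have O: "?O = {(p, q), (p, x1), (p, x2), (p, x3), (p, x4)}"
    by (simp add: x1 x2 x3 x4 eval_nat_numeral)
  have "x1 \<noteq> q"
  proof
    assume "x1 = q"
    then have "?O \<subseteq> {(p, q)}" using x1 x2 x3 x4 O by auto
    from card_mono[OF _ this] show False using deg(1) by (simp add: out_degree_def)
  qed
  then have l1: "x1 \<in> leaves T" using leaf x1 by blast
  have "x2 \<noteq> q"
  proof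
    assume "x2 = q"
    then have "?O \<subseteq> {(p, q), (p, x1)}" using x1 x2 x3 x4 O by auto
    from card_mono[OF _ this] show False
      using deg(1) by (simp add: out_degree_def card_insert_if split: if_splits)
  qed
  then have l2: "x2 \<in> leaves T" using leaf x2 by blast
  have step: "nxt x = y"
    if "\<sigma> (p, x) = (p, y)" "(p, x) \<in> parcs T" "x \<in> leaves T" "y \<in> leaves T" for x y
    using next_leaf_rotation[OF p(2) that(2,4,1) nxt[OF that(3)]] .
  have n1: "nxt x1 = x2" using step x1 x2 l1 l2 by blast
  show ?thesis
  proof (intro bexI[OF _ l2] conjI[OF x2(2)] ballI impI)
    fix y assume y: "y \<in> leaves T" "(p, y) \<in> parcs T"
    then have "(p, y) \<in> ?O" by simp
    then consider "y = q" | "y = x1" | "y = x2" | "y = x3" | "y = x4" unfolding O by auto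
    then show "y = x2 \<or> nxt y = x2 \<or> nxt (nxt y) = x2 \<or> y = nxt x2 \<or> y = nxt (nxt x2)"
    proof cases
      case 1
      then show ?thesis using step[OF x1(1)] q y l1 n1 by simp
    next
      case 4
      then show ?thesis using step[OF x3(1)] x2 l2 y by simp
    next
      case 5
      show ?thesis
      proof (cases "x3 = q")
        case True
        then show ?thesis using x1 x4 5 n1 by simp
      next
        case False
        then have "x3 \<in> leaves T" using leaf x3 by blast
        then show ?thesis using step[OF x3(1)] step[OF x4(1)] x2 x3 l2 y 5 by simp
      qed
    qed (use n1 in auto)
  qed
qed

end


section \<open>Halin graphs of maximum degree five\<close>

theorem theorem1p2:
  fixes G :: "'a pair_pre_digraph"
  assumes "halin G"
    and "max_degree G \<le> 5"
  shows "packing_colorable G [1, 1, 2, 2, 2]"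
proof -
  obtain T \<sigma> cs where "plane_tree T \<sigma>"
    and no2: "\<And>v. v \<in> pverts T \<Longrightarrow> out_degree T v \<noteq> 2"
    and adj: "adjoint_cycle T \<sigma> cs"
    and vG: "pverts G = pverts T" and aG: "parcs G = parcs T \<union> cycle_arcs cs"
    using assms(1) unfolding halin_def by blast
  interpret plane_tree T \<sigma> by fact
  interpret T: pair_graph T by (rule pair_graph_T)
  let ?L = "leaves T"
  define n where "n = length cs"
  have n: "3 \<le> n" and card_L: "card ?L = n"
    using adj distinct_card[of cs] by (auto simp: adjoint_cycle_def n_def)
  have L_sub: "?L \<subseteq> pverts T" by (auto simp: leaves_def)
  have inner: "x \<notin> ?L" if "l \<in> ?L" "(l, x) \<in> parcs T" for l x
    using leaf_neighbour_inner[OF _ that] n card_L by simp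

  \<comment> \<open>Degrees in the tree are bounded by degrees in the Halin graph.\<close>
  have deg5: "out_degree T v \<le> 5" if "v \<in> pverts T" for v
  proof -
    have "parcs G \<subseteq> pverts T \<times> pverts T"
      using aG cycle_arcs_subset[of cs] L_sub adj arc_verts by (auto simp: adjoint_cycle_def)
    then have "finite (parcs G)" using finite_T(1) finite_subset by blast
    then have "out_degree T v \<le> out_degree G v"
      unfolding out_degree_def using aG by (intro card_mono) (auto simp: out_arcs_def)
    also have "\<dots> \<le> max_degree G"
      unfolding max_degree_def using vG finite_T(1) that by (intro Max_ge) auto
    finally show ?thesis using assms(2) by simp
  qed
  have deg3: "3 \<le> out_degree T v" if "v \<in> pverts T" "v \<notin> ?L" for v
  proof -
    have "out_degree T v \<noteq> 0"
    proof
      assume "out_degree T v = 0"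
      then have "out_arcs T v = {}"
        using finite_T(2) by (simp add: out_degree_def out_arcs_def)
      then have "(v, y) \<notin> parcs T" for y by (auto simp: out_arcs_def)
      then have "pverts T \<subseteq> {v}"
        using connected_closed_subset[OF pair_graph_T _ _ that(1), of "{v}"] tree
        by (auto simp: undirected_tree_def)
      then have "card ?L \<le> card {v}" using L_sub by (intro card_mono) auto
      then show False using n card_L by simp
    qed
    moreover have "out_degree T v \<noteq> 1" using that by (auto simp: leaves_def)
    ultimately show ?thesis using no2[OF that(1)] by linarith
  qed

  have arcsV: "parcs T \<subseteq> pverts T \<times> pverts T" using arc_verts by auto
  have symT: "sym (parcs T)" using arc_sym by (auto intro: symI)
  have irreflT: "irrefl (parcs T)" using T.no_loops' by (auto simp: irrefl_def)
  have acycT: "acyclic_edges (parcs T)" using tree by (rule undirected_tree_acyclic_edges)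
  obtain c :: "'a \<Rightarrow> bool" where c: "\<And>x y. (x, y) \<in> parcs T \<Longrightarrow> c x \<noteq> c y"
    using acyclic_edges_bipartite[OF finite_T(1) arcsV symT irreflT acycT] by blast

  \<comment> \<open>An end of the forest of inner vertices: a vertex with at most one inner neighbour.\<close>
  let ?I = "pverts T - ?L"
  obtain p where p: "p \<in> pverts T" "p \<notin> ?L"
    and outer: "\<And>x y. (p, x) \<in> parcs T \<Longrightarrow> (p, y) \<in> parcs T \<Longrightarrow> x \<notin> ?L \<Longrightarrow> y \<notin> ?L \<Longrightarrow> x = y"
  proof -
    obtain l where l: "l \<in> ?L" using card_L n by fastforce
    then have "?I \<noteq> {}" using leaf_has_neighbour inner[OF l] arc_verts by blast
    moreover have "sym (parcs T \<inter> ?I \<times> ?I)" using symT by (auto simp: sym_def)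
    moreover have "irrefl (parcs T \<inter> ?I \<times> ?I)" using irreflT by (auto simp: irrefl_def)
    moreover have "acyclic_edges (parcs T \<inter> ?I \<times> ?I)"
      using acycT by (rule acyclic_edges_subset) auto
    ultimately obtain p where "p \<in> ?I"
      "\<And>x y. (p, x) \<in> parcs T \<inter> ?I \<times> ?I \<Longrightarrow> (p, y) \<in> parcs T \<inter> ?I \<times> ?I \<Longrightarrow> x = y"
      using acyclic_edges_end[of ?I "parcs T \<inter> ?I \<times> ?I"] finite_T(1) by blast
    then show ?thesis using arc_verts by (intro that[of p]) blast+
  qed

  have cs: "distinct cs" "set cs = ?L" "length cs = n"
    "\<And>i. i < n \<Longrightarrow> next_leaf T \<sigma> (cs ! i) (cs ! (Suc i mod n))"
    using adj by (auto simp: adjoint_cycle_def n_def)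
  obtain nxt where nxt_cs: "\<And>i. i < n \<Longrightarrow> nxt (cs ! i) = cs ! (Suc i mod n)"
    using distinct_nth_function[OF cs(1), of "\<lambda>i. cs ! (Suc i mod n)"] unfolding cs(3) by metis
  have nxt: "next_leaf T \<sigma> x (nxt x)" if leaf: "x \<in> ?L" for x
  proof -
    obtain i where i: "i < n" "x = cs ! i"
      using leaf cs(2,3) by (metis in_set_conv_nth)
    show ?thesis unfolding i(2) nxt_cs[OF i(1)] by (rule cs(4)[OF i(1)])
  qed
  obtain x where x: "x \<in> ?L" "(p, x) \<in> parcs T" and near: "\<And>y. y \<in> ?L \<Longrightarrow> (p, y) \<in> parcs T \<Longrightarrow>
      y = x \<or> nxt y = x \<or> nxt (nxt y) = x \<or> y = nxt x \<or> y = nxt (nxt x)"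
    using bunched_siblings[OF p deg3[OF p] deg5[OF p(1)] outer nxt] by blast

  \<comment> \<open>Cut the cycle right after x, so that x gets the last position; the siblings of x then have the
    positions from n - 3 on or 0 or 1.\<close>
  obtain t where t: "t < n" "cs ! t = x"
    using x(1) cs(2,3) by (metis in_set_conv_nth)
  define ds where "ds = rotate (Suc t) cs"
  have ds: "distinct ds" "set ds = ?L" "length ds = n" and arcs_ds: "cycle_arcs cs = cycle_arcs ds"
    using cs(1-3) by (simp_all add: ds_def cycle_arcs_rotate del: rotate_Suc)
  have ds_nth: "ds ! i = cs ! ((Suc t + i) mod n)" if "i < n" for i
    using that cs(3) unfolding ds_def by (subst nth_rotate) auto
  have lt: "k mod n < n" for k using n by simp
  have nxt_ds: "nxt (ds ! i) = ds ! (Suc i mod n)" if "i < n" for i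
  proof -
    have "nxt (ds ! i) = cs ! (Suc ((Suc t + i) mod n) mod n)"
      unfolding ds_nth[OF that] by (rule nxt_cs[OF lt])
    also have "\<dots> = ds ! (Suc i mod n)"
      unfolding ds_nth[OF lt] mod_add_right_eq mod_Suc_eq by simp
    finally show ?thesis .
  qed
  have last: "ds ! (n - 1) = x"
  proof -
    have "Suc t + (n - 1) = t + n" using n by simp
    then have "ds ! (n - 1) = cs ! (t mod n)" 
      using ds_nth[of "n - 1"] n unfolding \<open>Suc t + (n - 1) = t + n\<close> by simp
    then show ?thesis using t by (metis mod_less)
  qed
  have eq_iff: "ds ! i = ds ! j \<longleftrightarrow> i = j" if "i < n" "j < n" for i j
    using nth_eq_iff_index_eq[OF ds(1)] that unfolding ds(3) by blast
  have ds_L: "ds ! i \<in> ?L" if "i < n" for i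
    using nth_mem[of i ds] that unfolding ds(2,3) .

  obtain par where par: "\<And>l. l \<in> ?L \<Longrightarrow> (l, par l) \<in> parcs T" using leaf_has_neighbour by metis
  have par_eq: "par l = v" if "l \<in> ?L" "(l, v) \<in> parcs T" for l v
    using leaf_neighbour_unique[OF that(1) par[OF that(1)] that(2)] .

  have sparse: "par (ds ! j) \<noteq> par (ds ! k)"
    if "Suc i < j" "Suc j < k" "Suc k < n" "par (ds ! i) = par (ds ! j)" for i j k
  proof
    assume same: "par (ds ! j) = par (ds ! k)"
    let ?X = "{ds ! i, ds ! j, ds ! k}" and ?v = "par (ds ! i)"
    have ijk: "i < n" "j < n" "k < n" "i \<noteq> j" "j \<noteq> k" "i \<noteq> k" using that by auto
    have X: "?X \<subseteq> ?L" using ijk ds_L by blast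
    have v: "?v \<in> pverts T" "?v \<notin> ?L"
      using par[OF ds_L] inner[OF ds_L] arc_verts ijk(1) by blast+
    \<comment> \<open>Pairwise non-adjacent siblings fill at most half of the at most five arcs at their parent.\<close>
    have "2 * card ?X \<le> out_degree T ?v"
    proof (rule card_separated_siblings[OF v(2) X])
      show "(?v, y) \<in> parcs T" if "y \<in> ?X" for y
      proof -
        have "par y = ?v" using that same \<open>?v = par (ds ! j)\<close> by auto
        then show ?thesis using par[of y] that X arc_sym by auto
      qed
      show "next_leaf T \<sigma> y (nxt y)" if "y \<in> ?X" for y
        using nxt[OF subsetD[OF X that]] .
      show "nxt y \<notin> ?X" if "y \<in> ?X" for y
        using that \<open>Suc i < j\<close> \<open>Suc j < k\<close> \<open>Suc k < n\<close> by (auto simp: nxt_ds eq_iff)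
    qed
    moreover have "card ?X = 3" using ijk by (simp add: eq_iff)
    ultimately show False using deg5[OF v(1)] by simp
  qed
  have bunched: "j \<le> 1 \<or> n \<le> j + 3" if j: "j < n" and same: "par (ds ! j) = par (ds ! (n - 1))" for j
  proof -
    have "par x = p" using par_eq[OF x(1)] arc_sym[OF x(2)] by simp
    then have "(p, ds ! j) \<in> parcs T" using arc_sym[OF par[OF ds_L[OF j]]] same last by simp
    note near[OF ds_L[OF j] this]
    moreover have "n - 1 < n" using n by simp
    ultimately consider "j = n - 1" | "Suc j mod n = n - 1" | "Suc (Suc j) mod n = n - 1"
      | "j = Suc (n - 1) mod n" | "j = Suc (Suc (n - 1)) mod n"
      unfolding last[symmetric] using j lt by (auto simp only: nxt_ds eq_iff mod_Suc_eq)
    then show ?thesis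
      using j n by cases (auto simp: mod_if split: if_splits)
  qed

  let ?S = "selected n"
  have "\<exists>f :: nat \<Rightarrow> nat. (\<forall>i \<in> ?S. f i < 3) \<and> (\<forall>i \<in> ?S. \<forall>j \<in> ?S. i \<noteq> j \<longrightarrow>
      par (ds ! i) = par (ds ! j) \<or> j = Suc i mod n \<or> j = Suc (Suc i) mod n \<longrightarrow> f i \<noteq> f j)"
    by (rule selected_colouring[OF n]) (fact sparse, fact bunched)
  then obtain f :: "nat \<Rightarrow> nat" where f3: "\<forall>i \<in> ?S. f i < 3"
    and f_ball: "\<forall>i \<in> ?S. \<forall>j \<in> ?S. i \<noteq> j \<longrightarrow>
      par (ds ! i) = par (ds ! j) \<or> j = Suc i mod n \<or> j = Suc (Suc i) mod n \<longrightarrow> f i \<noteq> f j"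
    by (elim exE conjE)
  note f = f_ball[rule_format]
  have S: "i < n" if "i \<in> ?S" for i using that by (simp add: selected_def)
  obtain g where g: "\<And>i. i < n \<Longrightarrow> g (ds ! i) = f i"
    using distinct_nth_function[OF ds(1), of f] unfolding ds(3) by metis
  let ?W = "(!) ds ` ?S"
  have W_L: "?W \<subseteq> ?L" using S ds_L by auto
  \<comment> \<open>Selected leaves get the colours 2, 3, 4, all other vertices keep the bipartition of the tree.
    This is proper on the cycle because every edge of the cycle has a selected end.\<close>
  define col where "col v = (if v \<in> ?W then 2 + g v else if c v then 0 else 1)" for v
  have col_W: "col (ds ! i) = 2 + f i" if "i \<in> ?S" for i
    using that S g by (simp add: col_def)
  have col_notW: "col v = (if c v then 0 else 1)" if "v \<notin> ?W" for v
    using that by (simp add: col_def)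

  have cycle_arc: "\<exists>j<n. y = ds ! j \<and> (j = Suc i mod n \<or> i = Suc j mod n)"
    if "i < n" "(ds ! i, y) \<in> cycle_arcs cs" for i y
    using cycle_arcs_nthD[OF ds(1), of i y] that ds(3) arcs_ds by simp
  have cycle_sub: "cycle_arcs cs \<subseteq> ?L \<times> ?L" using cycle_arcs_subset[of cs] cs(2) by simp

  show ?thesis
  proof (rule packing_colorable_11222I)
    show "wf_digraph (with_proj G)"
      using vG aG cycle_sub L_sub arc_verts by unfold_locales auto
    show "col v < 5" if "v \<in> pverts G" for v
      using f3 S g by (auto simp: col_def)
    show "col u \<noteq> col v" if uv: "(u, v) \<in> parcs G" "u \<noteq> v" for u v
    proof (cases "u \<in> ?W \<and> v \<in> ?W")
      case True
      then obtain i j where ij: "i \<in> ?S" "j \<in> ?S" "u = ds ! i" "v = ds ! j" by auto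
      have "u \<in> ?L" "v \<in> ?L" using True W_L by blast+
      then have "(u, v) \<in> cycle_arcs cs" using uv(1) aG inner by blast
      then have "j = Suc i mod n \<or> i = Suc j mod n"
        using cycle_arc[of i v] ij S by (auto simp: eq_iff)
      then have "f i \<noteq> f j" using f[of i j] f[of j i] ij uv(2) by metis
      then show ?thesis using ij col_W by simp
    next
      case False
      have "u \<in> ?W \<or> v \<in> ?W \<or> (u, v) \<in> parcs T"
      proof (cases "(u, v) \<in> cycle_arcs cs")
        case True
        then obtain i where i: "i < n" "u = ds ! i"
          using cycle_sub ds(2,3) by (metis in_set_conv_nth mem_Sigma_iff subsetD)
        then show ?thesis
          using cycle_arc[of i v] True selected_cover by blast
      qed (use uv aG in auto)
      then show ?thesis using False c[of u v] by (auto simp: col_def)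
    qed
    show "col u \<noteq> col v"
      if path: "(u, w) \<in> parcs G" "(w, v) \<in> parcs G" and "u \<noteq> v" "2 \<le> col u" for u v w
    proof (cases "v \<in> ?W")
      case False
      then show ?thesis using \<open>2 \<le> col u\<close> by (auto simp: col_notW)
    next
      case True
      have "u \<in> ?W" using \<open>2 \<le> col u\<close> by (auto simp: col_def split: if_splits)
      with True obtain i j where ij: "i \<in> ?S" "j \<in> ?S" "u = ds ! i" "v = ds ! j" by auto
      have ltn: "i < n" "j < n" using ij S by auto
      have L: "u \<in> ?L" "v \<in> ?L" using ij ltn ds_L by auto
      \<comment> \<open>Two leaves at distance at most two have the same parent or are close on the cycle: a common
    neighbour is adjacent to both in the tree if it is inner, and to both on the cycle if it is a leaf.\<close>
      have "par u = par v \<or> j = Suc (Suc i) mod n \<or> i = Suc (Suc j) mod n"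
      proof (cases "w \<in> ?L")
        case False
        then have "(u, w) \<in> parcs T" "(w, v) \<in> parcs T" using path aG cycle_sub by auto
        then have "par u = w" "par v = w" using par_eq[OF L(1)] par_eq[OF L(2)] arc_sym by blast+
        then show ?thesis by simp
      next
        case True
        then have "(u, w) \<in> cycle_arcs cs" "(w, v) \<in> cycle_arcs cs"
          using path aG inner L arc_sym by blast+
        then obtain k where k: "k < n" "w = ds ! k" "k = Suc i mod n \<or> i = Suc k mod n"
            "j = Suc k mod n \<or> k = Suc j mod n"
        proof -
          obtain k where k: "k < n" "w = ds ! k" "k = Suc i mod n \<or> i = Suc k mod n"
            using cycle_arc[OF ltn(1)] \<open>(u, w) \<in> cycle_arcs cs\<close> ij(3) by blast
          moreover obtain j' where "j' < n" "v = ds ! j'" "j' = Suc k mod n \<or> k = Suc j' mod n"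
            using cycle_arc[OF k(1)] \<open>(w, v) \<in> cycle_arcs cs\<close> k(2) by blast
          ultimately show ?thesis using that ij(4) ltn(2) eq_iff by metis
        qed
        have "i \<noteq> j" using ij \<open>u \<noteq> v\<close> by auto
        have inj: "Suc i mod n \<noteq> Suc j mod n"
          using ltn \<open>i \<noteq> j\<close> by (auto simp: mod_if split: if_splits)
        show ?thesis using k(3,4) inj \<open>i \<noteq> j\<close> by (auto simp: mod_simps)
      qed
      then have "f i \<noteq> f j" using f[of i j] f[of j i] ij \<open>u \<noteq> v\<close> by metis
      then show ?thesis using ij col_W by simp
    qed
  qed
qed

end
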